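(* Let $p$ be a prime, let $\mathbb{F}$ be the field of order $p$, and let $\ell\geq 2$ be an integer such that $p$ and $\ell$ are coprime. Let $\mathbb{K}:=\mathbb{F}((X))$ be the field of formal Laurent series over $\mathbb{F}$. Then $$\mathbb{F}[[X^\ell]]:=\left\{\sum_{k=0}^\infty a_kX^{\ell k}\colon (a_k)_{k\in\mathbb{N}_0}\in\mathbb{F}^{\mathbb{N}_0}\right\}$$ is a constancy-enforcing subset of the $\mathbb{K}$-analytic manifold $\mathbb{K}=\mathbb{F}((X))$.
   Context: $\mathbb{N}_0=\{0,1,2,\ldots\}$. The field $\mathbb{K}=\mathbb{F}((X))$ carries its usual locally compact topology, defined by an absolute value with $0<|X|<1$, and is regarded as a $1$-dimensional $\mathbb{K}$-analytic manifold. $\mathbb{K}$-analytic manifolds are finite-dimensional, modeled on $\mathbb{K}^m$ with $m\in\mathbb{N}_0$, with analytic maps (locally given by convergent power series) as in Serre's "Lie Algebras and Lie Groups". Constancy-enforcing: a subset $N$ of a $\mathbb{K}$-analytic manifold $M$ is called constancy-enforcing if, for each $\mathbb{K}$-analytic manifold $Z$, each $\mathbb{K}$-analytic map $f\colon Z\to M$ with image $f(Z)\subseteq N$ is locally constant. *)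

theory Defs
  imports
    "HOL-Analysis.Analysis"
    "HOL-Computational_Algebra.Formal_Laurent_Series"
begin

text \<open>
  Throughout, the ground field is \<open>\<bbbK> = 'a fls\<close>, the field of formal Laurent series over \<open>'a\<close>.
  Its library metric is \<open>dist x y = \<bar>x - y\<bar>\<close> for the absolute value
  \<open>\<bar>x\<bar> = 2 powi (- fls_subdegree x)\<close> (\<open>x \<noteq> 0\<close>), so that \<open>\<bar>X\<bar> = 1/2\<close>.

  The space \<open>\<bbbK>\<^sup>m\<close>, where \<open>m = 0\<close> is allowed, consists of the functions on \<open>{..<m}\<close>,
  extended by \<open>undefined\<close> to all of \<open>nat\<close>; multi-indices are represented likewise.
\<close>

definition fls_space :: "nat \<Rightarrow> (nat \<Rightarrow> 'a::field fls) topology" where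
  "fls_space m = product_topology (\<lambda>_. euclidean) {..<m}"

definition fls_polydisc :: "nat \<Rightarrow> (nat \<Rightarrow> 'a::field fls) \<Rightarrow> real \<Rightarrow> (nat \<Rightarrow> 'a fls) set" where
  "fls_polydisc m a r = {x \<in> topspace (fls_space m). \<forall>i<m. dist (x i) (a i) < r}"

definition multi_indices :: "nat \<Rightarrow> (nat \<Rightarrow> nat) set" where
  "multi_indices m = ({..<m} \<rightarrow>\<^sub>E UNIV)"

text \<open>
  A scalar function on an open subset of \<open>\<bbbK>\<^sup>m\<close> is analytic if around each point it is
  given by a power series that converges on a polydisc; a map into \<open>\<bbbK>\<^sup>n\<close> is analytic if
  its components are.
\<close>

definition fls_analytic :: "nat \<Rightarrow> (nat \<Rightarrow> 'a::field fls) set \<Rightarrow> ((nat \<Rightarrow> 'a fls) \<Rightarrow> 'a fls) \<Rightarrow> bool" where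
  "fls_analytic m U g \<longleftrightarrow>
     openin (fls_space m) U \<and>
     (\<forall>a\<in>U. \<exists>r>0. \<exists>c :: (nat \<Rightarrow> nat) \<Rightarrow> 'a fls.
        fls_polydisc m a r \<subseteq> U \<and>
        (\<forall>x\<in>fls_polydisc m a r.
           ((\<lambda>\<alpha>. c \<alpha> * (\<Prod>i<m. (x i - a i) ^ \<alpha> i)) has_sum g x) (multi_indices m)))"

definition fls_analytic_vec ::
    "nat \<Rightarrow> nat \<Rightarrow> (nat \<Rightarrow> 'a::field fls) set \<Rightarrow> ((nat \<Rightarrow> 'a fls) \<Rightarrow> nat \<Rightarrow> 'a fls) \<Rightarrow> bool" where
  "fls_analytic_vec m n U g \<longleftrightarrow>
     openin (fls_space m) U \<and> g ` U \<subseteq> topspace (fls_space n) \<and>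
     (\<forall>j<n. fls_analytic m U (\<lambda>x. g x j))"

text \<open>
  As in Serre's book, every chart carries its own dimension, and a manifold is a topological
  space with an atlas of compatible charts. Two atlases whose union is an atlas describe the
  same manifold; the notions below do not depend on this choice. The coordinate map of a chart
  is only relevant on the domain of the chart.
\<close>

datatype ('z, 'k) chart =
  Chart (chart_dim: nat) (chart_dom: "'z set") (chart_map: "'z \<Rightarrow> nat \<Rightarrow> 'k")

definition chart_range :: "('z, 'k) chart \<Rightarrow> (nat \<Rightarrow> 'k) set" where
  "chart_range c = chart_map c ` chart_dom c"

definition chart_inv :: "('z, 'k) chart \<Rightarrow> (nat \<Rightarrow> 'k) \<Rightarrow> 'z" where
  "chart_inv c = inv_into (chart_dom c) (chart_map c)"

definition chart_on :: "'z topology \<Rightarrow> ('z, 'a::field fls) chart \<Rightarrow> bool" where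
  "chart_on Z c \<longleftrightarrow>
     openin Z (chart_dom c) \<and>
     openin (fls_space (chart_dim c)) (chart_range c) \<and>
     homeomorphic_map (subtopology Z (chart_dom c))
       (subtopology (fls_space (chart_dim c)) (chart_range c)) (chart_map c)"

text \<open>Quantified over all ordered pairs of charts below, this covers both transition maps.\<close>

definition analytic_transition :: "('z, 'a::field fls) chart \<Rightarrow> ('z, 'a fls) chart \<Rightarrow> bool" where
  "analytic_transition c d \<longleftrightarrow>
     fls_analytic_vec (chart_dim c) (chart_dim d)
       (chart_map c ` (chart_dom c \<inter> chart_dom d)) (chart_map d \<circ> chart_inv c)"

definition analytic_manifold :: "'z topology \<Rightarrow> ('z, 'a::field fls) chart set \<Rightarrow> bool" where
  "analytic_manifold Z A \<longleftrightarrow>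
     (\<forall>c\<in>A. chart_on Z c) \<and>
     (\<Union>c\<in>A. chart_dom c) = topspace Z \<and>
     (\<forall>c\<in>A. \<forall>d\<in>A. analytic_transition c d)"

definition analytic_map ::
    "'z topology \<Rightarrow> ('z, 'a::field fls) chart set \<Rightarrow> 'm topology \<Rightarrow> ('m, 'a fls) chart set \<Rightarrow> ('z \<Rightarrow> 'm) \<Rightarrow> bool" where
  "analytic_map Z A M B f \<longleftrightarrow>
     continuous_map Z M f \<and>
     (\<forall>c\<in>A. \<forall>d\<in>B.
        fls_analytic_vec (chart_dim c) (chart_dim d)
          (chart_map c ` (chart_dom c \<inter> f -` chart_dom d)) (chart_map d \<circ> f \<circ> chart_inv c))"

definition locally_constant :: "'z topology \<Rightarrow> ('z \<Rightarrow> 'm) \<Rightarrow> bool" where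
  "locally_constant Z f \<longleftrightarrow>
     (\<forall>z\<in>topspace Z. \<exists>U. openin Z U \<and> z \<in> U \<and> f constant_on U)"

text \<open>
  A definition cannot quantify over types, so the type \<open>'z\<close> in which the underlying sets of the
  test manifolds \<open>Z\<close> lie is a parameter. The set \<open>N\<close> is constancy-enforcing if this predicate
  holds for every \<open>'z\<close>; a theorem states this by leaving \<open>'z\<close> a type variable.
\<close>

definition constancy_enforcing ::
    "'z itself \<Rightarrow> 'm topology \<Rightarrow> ('m, 'a::field fls) chart set \<Rightarrow> 'm set \<Rightarrow> bool" where
  "constancy_enforcing (_ :: 'z itself) M B N \<longleftrightarrow>
     analytic_manifold M B \<and> N \<subseteq> topspace M \<and>
     (\<forall>(Z :: 'z topology) (A :: ('z, 'a fls) chart set) f.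
        analytic_manifold Z A \<and> analytic_map Z A M B f \<and> f ` topspace Z \<subseteq> N
          \<longrightarrow> locally_constant Z f)"

text \<open>The field \<open>\<bbbK>\<close> as a 1-dimensional manifold, with \<open>\<bbbK> \<cong> \<bbbK>\<^sup>1\<close> as its only chart.\<close>

definition fls_chart :: "('a::field fls, 'a fls) chart" where
  "fls_chart = Chart 1 UNIV (\<lambda>x. \<lambda>i\<in>{..<1}. x)"

text \<open>The subset \<open>\<FF>[[X\<^sup>l]]\<close>: the sums of all series \<open>\<Sum>k. a\<^sub>k X\<^bsup>lk\<^esup>\<close>.\<close>

definition power_series_in_X_power :: "nat \<Rightarrow> 'a::field fls set" where
  "power_series_in_X_power l =
     {s. \<exists>a :: nat \<Rightarrow> 'a. (\<lambda>k. fls_const (a k) * fls_X ^ (l * k)) sums s}"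

lemma fls_analytic_coordinate:
  "fls_analytic 1 (topspace (fls_space 1)) (\<lambda>x. x 0 :: 'a::field fls)"
  unfolding fls_analytic_def
proof (intro conjI ballI)
  fix a :: "nat \<Rightarrow> 'a fls"
  define e :: "nat \<Rightarrow> nat \<Rightarrow> nat" where "e k = (\<lambda>i\<in>{..<1}. k)" for k
  define c where "c \<alpha> = (if \<alpha> = e 0 then a 0 else if \<alpha> = e 1 then 1 else 0)" for \<alpha>
  have e: "e k 0 = k" "e k \<in> multi_indices 1" for k
    by (auto simp: e_def multi_indices_def)
  have ne: "e 0 \<noteq> e 1" using e(1) by (metis zero_neq_one)
  have "((\<lambda>\<alpha>. c \<alpha> * (\<Prod>i<1. (x i - a i) ^ \<alpha> i)) has_sum x 0) (multi_indices 1)" for x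
  proof -
    have "((\<lambda>\<alpha>. c \<alpha> * (\<Prod>i<1. (x i - a i) ^ \<alpha> i)) has_sum x 0) {e 0, e 1}"
      by (rule has_sum_finiteI) (use ne e in \<open>auto simp: c_def\<close>)
    thus ?thesis
      by (subst has_sum_cong_neutral[where T = "{e 0, e 1}"
            and g = "\<lambda>\<alpha>. c \<alpha> * (\<Prod>i<1. (x i - a i) ^ \<alpha> i)"]) (use e in \<open>auto simp: c_def\<close>)
  qed
  thus "\<exists>r>0. \<exists>c :: (nat \<Rightarrow> nat) \<Rightarrow> 'a fls.
        fls_polydisc 1 a r \<subseteq> topspace (fls_space 1) \<and>
        (\<forall>x\<in>fls_polydisc 1 a r.
           ((\<lambda>\<alpha>. c \<alpha> * (\<Prod>i<1. (x i - a i) ^ \<alpha> i)) has_sum x 0) (multi_indices 1))"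
    by (intro exI[of _ "1::real"] conjI exI[of _ c]) (auto simp: fls_polydisc_def)
qed simp

lemma analytic_manifold_fls: "analytic_manifold euclidean {fls_chart :: ('a::field fls, 'a fls) chart}"
proof -
  let ?h = "\<lambda>x::'a fls. \<lambda>i\<in>{..<1::nat}. x"
  have range_h: "range ?h = topspace (fls_space 1)"
  proof
    show "topspace (fls_space 1) \<subseteq> range ?h"
    proof
      fix y :: "nat \<Rightarrow> 'a fls" assume "y \<in> topspace (fls_space 1)"
      hence "y = ?h (y 0)" by (auto simp: fls_space_def PiE_def extensional_def fun_eq_iff)
      thus "y \<in> range ?h" by blast
    qed
  qed (auto simp: fls_space_def split: if_split_asm)
  have inv: "inv_into UNIV ?h y = y 0" if "y \<in> topspace (fls_space 1)" for y
  proof -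
    have "?h (inv_into UNIV ?h y) = y"
      by (rule f_inv_into_f) (simp only: range_h that)
    from fun_cong[OF this, of 0] show ?thesis by simp
  qed
  have "homeomorphic_maps euclidean (fls_space 1) ?h (\<lambda>y. y 0)"
    unfolding homeomorphic_maps_def
  proof (intro conjI ballI)
    show "continuous_map euclidean (fls_space 1) ?h"
      by (auto simp: fls_space_def continuous_map_componentwise)
    show "continuous_map (fls_space 1) euclidean (\<lambda>y::nat \<Rightarrow> 'a fls. y 0)"
      unfolding fls_space_def by (rule continuous_map_product_projection) auto
    show "?h (y 0) = y" if "y \<in> topspace (fls_space 1)" for y
      using that by (auto simp: fls_space_def PiE_def extensional_def fun_eq_iff)
  qed simp_all
  hence "homeomorphic_map euclidean (fls_space 1) ?h"
    by (metis homeomorphic_map_maps)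
  hence "chart_on euclidean (fls_chart :: ('a fls, 'a fls) chart)"
    using range_h by (simp add: chart_on_def fls_chart_def chart_range_def)
  moreover have "fls_analytic 1 (topspace (fls_space 1)) (\<lambda>x. ?h (inv_into UNIV ?h x) j)"
    if "j < 1" for j
    using fls_analytic_coordinate[where ?'a = 'a] that inv
    by (simp add: fls_analytic_def fls_polydisc_def)
  hence "analytic_transition fls_chart (fls_chart :: ('a fls, 'a fls) chart)"
    using range_h by (auto simp: analytic_transition_def fls_analytic_vec_def fls_chart_def chart_inv_def)
  ultimately show ?thesis
    by (simp add: analytic_manifold_def) (simp add: fls_chart_def)
qed

end

theory Submission
  imports Defs "HOL-Number_Theory.Residues"
begin

unbundle Formal_Laurent_Series.fps_syntax

text \<open>
  An analytic map into \<open>\<bbbK>\<close> restricts, on the line through \<open>a\<close> and \<open>x\<close>, to a power series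
  \<open>h t = (\<Sum>k. Q\<^sub>k t\<^sup>k)\<close> that converges for \<open>\<bar>t\<bar> \<le> 1\<close>. If it is not constant, let \<open>n > 0\<close> be
  minimal with \<open>Q\<^sub>n \<noteq> 0\<close>, write \<open>n = p\<^sup>e m\<close> with \<open>p\<close> not dividing \<open>m\<close>, and compare \<open>h\<close> at \<open>0\<close>,
  at \<open>t = X\<^sup>N\<close> and at \<open>t = X\<^sup>N (1 + X)\<close> for large \<open>N\<close>. As \<open>(1 + X)\<^sup>n - 1\<close> has order \<open>p\<^sup>e\<close>, the
  differences of these values have the orders \<open>v(Q\<^sub>n) + n N\<close> and \<open>v(Q\<^sub>n) + n N + p\<^sup>e\<close>.
  All values lie in the additive group \<open>\<FF>[[X\<^sup>l]]\<close>, so \<open>l\<close> divides both orders and hence \<open>p\<^sup>e\<close>,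
  which contradicts the coprimality of \<open>p\<close> and \<open>l\<close>.
\<close>

section \<open>Orders of vanishing of Laurent series\<close>

text \<open>Order at least \<open>k\<close>, where \<open>0\<close> has infinite order. Since
  \<open>fls_subdegree 0 = 0\<close>, working with \<open>fls_subdegree\<close> directly would force
  a case distinction in every estimate.\<close>

definition fls_vanishes_below :: "int \<Rightarrow> 'a::zero fls \<Rightarrow> bool" where
  "fls_vanishes_below k f \<longleftrightarrow> (\<forall>j<k. f $$ j = 0)"

lemma fls_vanishes_below_iff: "fls_vanishes_below k f \<longleftrightarrow> f = 0 \<or> k \<le> fls_subdegree f"
  by (auto simp: fls_vanishes_below_def intro: fls_subdegree_geI)

lemma fls_vanishes_below_0 [simp]: "fls_vanishes_below k 0"
  by (simp add: fls_vanishes_below_def)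

lemma fls_vanishes_below_mono: "fls_vanishes_below k f \<Longrightarrow> k' \<le> k \<Longrightarrow> fls_vanishes_below k' f"
  by (auto simp: fls_vanishes_below_def)

lemma fls_vanishes_below_add:
  "fls_vanishes_below k f \<Longrightarrow> fls_vanishes_below k g \<Longrightarrow>
     fls_vanishes_below k (f + g :: 'a::monoid_add fls)"
  by (simp add: fls_vanishes_below_def)

lemma fls_vanishes_below_diff:
  "fls_vanishes_below k f \<Longrightarrow> fls_vanishes_below k g \<Longrightarrow>
     fls_vanishes_below k (f - g :: 'a::group_add fls)"
  by (simp add: fls_vanishes_below_def)

lemma fls_vanishes_below_sum:
  "(\<And>i. i \<in> F \<Longrightarrow> fls_vanishes_below k (f i)) \<Longrightarrow>
     fls_vanishes_below k (sum f F :: 'a::comm_monoid_add fls)"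
  by (induction F rule: infinite_finite_induct) (auto intro: fls_vanishes_below_add)

lemma fls_vanishes_below_mult:
  "fls_vanishes_below k f \<Longrightarrow> fls_vanishes_below k' g \<Longrightarrow>
     fls_vanishes_below (k + k') (f * g :: 'a::idom fls)"
  by (cases "f = 0 \<or> g = 0") (auto simp: fls_vanishes_below_iff)

lemma fls_vanishes_below_power:
  "fls_vanishes_below k f \<Longrightarrow> fls_vanishes_below (int n * k) (f ^ n :: 'a::idom fls)"
  by (cases "n = 0") (auto simp: fls_vanishes_below_iff fls_subdegree_pow intro: mult_left_mono)

lemma fls_vanishes_below_all_imp_eq:
  "(\<And>k::nat. fls_vanishes_below (int k) (f - g :: 'a::group_add fls)) \<Longrightarrow> f = g"
proof (rule fls_eqI)
  fix j assume *: "\<And>k::nat. fls_vanishes_below (int k) (f - g)"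
  have "j < int (Suc (nat j))" by linarith
  with * have "(f - g) $$ j = 0" unfolding fls_vanishes_below_def by blast
  thus "f $$ j = g $$ j" by simp
qed

lemma dist_fls_conv_powi:
  "f \<noteq> g \<Longrightarrow> dist f g = 2 powi (- fls_subdegree (f - g :: 'a::group_add fls))"
  by (auto simp: dist_fls_def power_int_def power_inverse[symmetric])

lemma dist_less_imp_vanishes_below:
  fixes f g :: "'a::group_add fls"
  assumes "dist f g < 2 powi (- k)"
  shows "fls_vanishes_below k (f - g)"
proof (cases "f = g")
  case False
  have "k \<le> fls_subdegree (f - g)"
  proof (rule ccontr)
    assume "\<not> k \<le> fls_subdegree (f - g)"
    hence "(2::real) powi (- k) \<le> 2 powi (- fls_subdegree (f - g))"
      by (intro power_int_increasing) auto
    thus False using assms False by (simp add: dist_fls_conv_powi)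
  qed
  thus ?thesis by (simp add: fls_vanishes_below_iff)
qed simp

text \<open>Keeps the line from \<open>a\<close> to \<open>x\<close> inside every polydisc around
  \<open>a\<close> that contains \<open>x\<close>. The parameter \<open>t = 0\<close> is covered
  because its \<open>fls_subdegree\<close> is 0.\<close>

lemma dist_fls_scale_le:
  fixes a x t :: "'a::idom fls"
  assumes "fls_subdegree t \<ge> 0"
  shows "dist (a + t * (x - a)) a \<le> dist x a"
proof (cases "t = 0 \<or> x = a")
  case False
  thus ?thesis using assms
    by (auto simp: dist_fls_conv_powi intro!: power_int_increasing)
qed auto

lemma has_sum_fls_obtain_finite:
  fixes f :: "'i \<Rightarrow> 'a::ab_group_add fls"
  assumes "(f has_sum s) I"
  obtains F where "finite F" "F \<subseteq> I"
    "\<forall>G. finite G \<and> F \<subseteq> G \<and> G \<subseteq> I \<longrightarrow> fls_vanishes_below k (sum f G - s)"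
proof -
  have "\<forall>\<^sub>F G in finite_subsets_at_top I. dist (sum f G) s < 2 powi (- k)"
    using assms unfolding has_sum_def by (rule tendstoD) simp
  then obtain F where F: "finite F" "F \<subseteq> I"
    "\<forall>G. finite G \<and> F \<subseteq> G \<and> G \<subseteq> I \<longrightarrow> dist (sum f G) s < 2 powi (- k)"
    unfolding eventually_finite_subsets_at_top by auto
  show ?thesis
    by (rule that[OF F(1,2)]) (use F(3) dist_less_imp_vanishes_below in blast)
qed

text \<open>Outside a finite set \<open>F\<close>, a term is the difference of two partial sums
  close to \<open>s\<close>; the finitely many terms in \<open>F\<close> have a least order.\<close>

lemma has_sum_fls_terms_vanish_below:
  fixes f :: "'i \<Rightarrow> 'a::ab_group_add fls"
  assumes "(f has_sum s) I"
  obtains k where "\<And>i. i \<in> I \<Longrightarrow> fls_vanishes_below k (f i)"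
proof -
  obtain F where F: "finite F" "F \<subseteq> I"
    and "\<forall>G. finite G \<and> F \<subseteq> G \<and> G \<subseteq> I \<longrightarrow> fls_vanishes_below 0 (sum f G - s)"
    by (rule has_sum_fls_obtain_finite[OF assms])
  hence *: "fls_vanishes_below 0 (sum f G - s)" if "finite G" "F \<subseteq> G" "G \<subseteq> I" for G
    using that by blast
  \<comment> \<open>The inserted 0 takes care of the terms outside \<open>F\<close> and keeps
    \<open>Min\<close> defined for empty \<open>F\<close>.\<close>
  define k where "k = Min (insert 0 ((\<lambda>i. fls_subdegree (f i)) ` F))"
  have k: "k \<le> 0" "\<And>i. i \<in> F \<Longrightarrow> k \<le> fls_subdegree (f i)"
    unfolding k_def using F(1) by (auto intro: Min_le)
  have "fls_vanishes_below k (f i)" if "i \<in> I" for i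
  proof (cases "i \<in> F")
    case True
    thus ?thesis using k by (simp add: fls_vanishes_below_iff)
  next
    case False
    have "fls_vanishes_below 0 ((sum f (insert i F) - s) - (sum f F - s))"
      by (rule fls_vanishes_below_diff; rule *) (use F that in auto)
    hence "fls_vanishes_below 0 (f i)" using False F(1) by simp
    thus ?thesis by (rule fls_vanishes_below_mono) (rule k)
  qed
  thus ?thesis using that by blast
qed

text \<open>Ultrametric principle: a summand of strictly higher order leaves the leading term
  untouched.\<close>

lemma fls_subdegree_add_eq:
  fixes f g :: "'a::group_add fls"
  assumes "f \<noteq> 0" "fls_vanishes_below (fls_subdegree f + 1) g"
  shows "f + g \<noteq> 0" "fls_subdegree (f + g) = fls_subdegree f"
proof -
  have "(f + g) $$ fls_subdegree f \<noteq> 0"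
    using assms by (auto simp: fls_vanishes_below_def)
  moreover have "(f + g) $$ j = 0" if "j < fls_subdegree f" for j
    using assms that by (auto simp: fls_vanishes_below_def)
  ultimately show "f + g \<noteq> 0" "fls_subdegree (f + g) = fls_subdegree f"
    using fls_subdegree_eqI[of "f + g" "fls_subdegree f"] by (metis fls_zero_nth)+
qed

section \<open>Power series in one variable\<close>

text \<open>For \<open>n = p ^ e * m\<close> with \<open>p\<close> not dividing \<open>m\<close>,
  Frobenius turns the power into \<open>(1 + Y) ^ m\<close> with \<open>Y = fps_X ^ (p ^ e)\<close>.
  The geometric sum splits off \<open>Y\<close>, and the cofactor \<open>S\<close> has constant term
  \<open>m\<close>, nonzero in the field.\<close>

lemma fls_subdegree_one_plus_X_power_minus_one:
  fixes n :: nat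
  assumes p: "prime p" "CHAR('a::field) = p" and n: "n > 0"
  obtains e where "(1 + fls_X :: 'a fls) ^ n - 1 \<noteq> 0"
    "fls_subdegree ((1 + fls_X :: 'a fls) ^ n - 1) = int (p ^ e)"
proof -
  obtain e m where nem: "n = p ^ e * m" "\<not> p dvd m"
    using multiplicity_decompose'[of n p] n p(1) by (metis less_numeral_extra(3) not_prime_unit)
  define Y :: "'a fps" where "Y = fps_X ^ (p ^ e)"
  define S where "S = (\<Sum>i<m. (1 + Y) ^ i)"
  have "fps_nth ((1 + Y) ^ i) 0 = 1" for i
    using prime_gt_0_nat[OF p(1)] by (simp add: fps_nth_power_0 Y_def zero_power)
  hence "fps_nth S 0 = of_nat m" by (simp add: S_def fps_sum_nth)
  hence S0: "fps_nth S 0 \<noteq> 0" using nem p by (simp add: of_nat_eq_0_iff_char_dvd)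
  have "(1 + fps_X :: 'a fps) ^ (p ^ e) = 1 + Y"
    using p by (subst freshmans_dream'[of _ e]) (simp_all add: Y_def)
  hence "Y * S = (1 + fps_X) ^ n - 1"
    by (simp add: nem power_mult power_diff_1_eq S_def)
  hence "(1 + fls_X :: 'a fls) ^ n - 1 = fps_to_fls (Y * S)"
    by (simp add: fps_to_fls_power)
  moreover from S0 have "S \<noteq> 0" "subdegree S = 0" by auto
  moreover have "Y \<noteq> 0" by (simp add: Y_def)
  moreover have "subdegree Y = p ^ e" by (simp add: Y_def)
  ultimately show ?thesis
    using that[of e] by (simp add: fls_subdegree_fls_to_fps)
qed

text \<open>Each term of degree above \<open>n\<close> has at least the claimed order; the others
  are finitely many and are grouped by degree. The index set is general so that multi-indices with
  their total degree fit directly.\<close>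

lemma fls_power_series_remainder:
  fixes T :: "'i \<Rightarrow> 'a::field fls" and d :: "'i \<Rightarrow> nat"
  assumes sum: "((\<lambda>i. T i * t ^ d i) has_sum s) I"
    and fin: "\<And>n. finite {i\<in>I. d i \<le> n}"
    and T: "\<And>i. i \<in> I \<Longrightarrow> fls_vanishes_below B (T i)"
    and t: "fls_vanishes_below (int N) t"
  shows "fls_vanishes_below (B + (int n + 1) * int N)
           (s - (\<Sum>k\<le>n. (\<Sum>i | i \<in> I \<and> d i = k. T i) * t ^ k))"
proof -
  define J where "J = {i\<in>I. d i \<le> n}"
  have J: "finite J" "J \<subseteq> I" using fin by (auto simp: J_def)
  let ?K = "B + (int n + 1) * int N" and ?u = "\<lambda>i. T i * t ^ d i"
  obtain F where F: "finite F" "F \<subseteq> I"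
    "\<forall>G. finite G \<and> F \<subseteq> G \<and> G \<subseteq> I \<longrightarrow> fls_vanishes_below ?K (sum ?u G - s)"
    by (rule has_sum_fls_obtain_finite[OF sum])
  \<comment> \<open>\<open>F\<close> secures closeness to \<open>s\<close>, and \<open>J\<close>
    contains all terms of degree at most \<open>n\<close>, so \<open>F - J\<close> has only terms of
    higher degree.\<close>
  have "fls_vanishes_below ?K (sum ?u (F \<union> J) - s)" using F J by auto
  moreover have "fls_vanishes_below ?K (sum ?u (F - J))"
  proof (rule fls_vanishes_below_sum)
    fix i assume i: "i \<in> F - J"
    hence "i \<in> I" "n < d i" using F(2) by (auto simp: J_def)
    hence "fls_vanishes_below (B + int (d i) * int N) (?u i)"
      by (intro fls_vanishes_below_mult fls_vanishes_below_power T t)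
    moreover have "(int n + 1) * int N \<le> int (d i) * int N"
      using \<open>n < d i\<close> by (intro mult_right_mono) auto
    ultimately show "fls_vanishes_below ?K (?u i)"
      using fls_vanishes_below_mono by fastforce
  qed
  ultimately have "fls_vanishes_below ?K (sum ?u (F - J) - (sum ?u (F \<union> J) - s))"
    by (rule fls_vanishes_below_diff[rotated])
  moreover have "sum ?u (F \<union> J) = sum ?u (F - J) + sum ?u J"
    using sum.union_disjoint[of "F - J" J ?u] F(1) J(1) by (simp add: Un_Diff_cancel2 Diff_disjoint Int_commute)
  moreover have "sum ?u J = (\<Sum>k\<le>n. (\<Sum>i | i \<in> I \<and> d i = k. T i) * t ^ k)"
  proof -
    have "sum ?u J = (\<Sum>k\<le>n. \<Sum>i | i \<in> J \<and> d i = k. ?u i)"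
      using J by (intro sum.group[symmetric]) (auto simp: J_def)
    also have "\<dots> = (\<Sum>k\<le>n. (\<Sum>i | i \<in> I \<and> d i = k. T i) * t ^ k)"
      unfolding sum_distrib_right by (intro sum.cong) (auto simp: J_def)
    finally show ?thesis .
  qed
  ultimately show ?thesis by (simp add: algebra_simps)
qed

text \<open>The parameters 0 and 1 will be the centre and an arbitrary point of a polydisc. Both
  values turn out to be the constant coefficient \<open>Q 0\<close>.\<close>

lemma fls_power_series_eq_at_0_1:
  fixes T :: "'i \<Rightarrow> 'a::field fls" and d :: "'i \<Rightarrow> nat"
  assumes p: "prime p" "CHAR('a) = p" and l: "l \<ge> 2" "coprime p l"
    and sum: "\<And>t. fls_subdegree t \<ge> 0 \<Longrightarrow> ((\<lambda>i. T i * t ^ d i) has_sum h t) I"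
    and fin: "\<And>n. finite {i\<in>I. d i \<le> n}"
    and supp: "\<And>t j. fls_subdegree t \<ge> 0 \<Longrightarrow> h t $$ j \<noteq> 0 \<Longrightarrow> int l dvd j"
  shows "h 1 = h 0"
proof -
  define Q where "Q k = (\<Sum>i | i \<in> I \<and> d i = k. T i)" for k
  \<comment> \<open>At \<open>t = 1\<close> the terms are the \<open>T i\<close> themselves, so
    convergence there bounds them uniformly.\<close>
  obtain B where B: "\<And>i. i \<in> I \<Longrightarrow> fls_vanishes_below B (T i)"
    using has_sum_fls_terms_vanish_below[OF sum[of 1]] by auto
  have rem: "fls_vanishes_below (B + (int n + 1) * int N) (h t - (\<Sum>k\<le>n. Q k * t ^ k))"
    if "fls_vanishes_below (int N) t" for n N t
  proof -
    have "fls_subdegree t \<ge> 0" using that by (auto simp: fls_vanishes_below_iff)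
    from fls_power_series_remainder[OF sum[OF this] fin B that] show ?thesis
      unfolding Q_def .
  qed
  have "h 0 = Q 0"
  proof (rule fls_vanishes_below_all_imp_eq)
    fix k :: nat
    \<comment> \<open>The parameter \<open>t = 0\<close> vanishes to every order, so
      \<open>N\<close> is free and degree bound 0 suffices.\<close>
    from rem[of "nat (int k - B)" 0 0] have
      "fls_vanishes_below (B + int (nat (int k - B))) (h 0 - Q 0)" by simp
    thus "fls_vanishes_below (int k) (h 0 - Q 0)"
      by (rule fls_vanishes_below_mono) linarith
  qed
  moreover have "h 1 = Q 0"
  proof (cases "\<exists>n>0. Q n \<noteq> 0")
    case False
    show ?thesis
    proof (rule fls_vanishes_below_all_imp_eq)
      fix k :: nat
      \<comment> \<open>For \<open>t = 1\<close> only \<open>N = 0\<close> is possible in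
        \<open>rem\<close>, whose bound then stays at \<open>B\<close>. Instead, \<open>F\<close> is
        enlarged to all indices of degree at most \<open>n\<close>, where the sum collapses to
        \<open>Q 0\<close>.\<close>
      obtain F where F: "finite F" "F \<subseteq> I"
        "\<forall>G. finite G \<and> F \<subseteq> G \<and> G \<subseteq> I \<longrightarrow>
           fls_vanishes_below k (sum (\<lambda>i. T i * 1 ^ d i) G - h 1)"
        by (rule has_sum_fls_obtain_finite[OF sum[of 1], where k = "int k"]) auto
      define n where "n = Max (insert 0 (d ` F))"
      define G where "G = {i\<in>I. d i \<le> n}"
      have G: "finite G" "F \<subseteq> G" "G \<subseteq> I" using fin F by (auto simp: G_def n_def)
      have "sum T G = (\<Sum>k\<le>n. \<Sum>i | i \<in> G \<and> d i = k. T i)"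
        using G by (intro sum.group[symmetric]) (auto simp: G_def)
      also have "\<dots> = (\<Sum>k\<le>n. Q k)"
        unfolding Q_def by (intro sum.cong) (auto simp: G_def)
      also have "\<dots> = (\<Sum>k\<in>{0}. Q k)"
        using False by (intro sum.mono_neutral_right) auto
      finally have "fls_vanishes_below k (Q 0 - h 1)" using F(3) G by force
      from fls_vanishes_below_diff[OF fls_vanishes_below_0 this]
      show "fls_vanishes_below k (h 1 - Q 0)" by simp
    qed
  next
    case True
    define n where "n = (LEAST n. n > 0 \<and> Q n \<noteq> 0)"
    have n: "n > 0" "Q n \<noteq> 0" using LeastI_ex[OF True] by (auto simp: n_def)
    have Qk: "Q k = 0" if "0 < k" "k < n" for k
      using not_less_Least[of k "\<lambda>n. n > 0 \<and> Q n \<noteq> 0"] that by (auto simp: n_def)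
    have sumQ: "(\<Sum>k\<le>n. Q k * t ^ k) = Q 0 + Q n * t ^ n" for t
    proof -
      have "(\<Sum>k\<le>n. Q k * t ^ k) = (\<Sum>k\<in>{0, n}. Q k * t ^ k)"
        using Qk by (intro sum.mono_neutral_right) auto
      thus ?thesis using n(1) by simp
    qed
    obtain e where e: "(1 + fls_X :: 'a fls) ^ n - 1 \<noteq> 0"
      "fls_subdegree ((1 + fls_X :: 'a fls) ^ n - 1) = int (p ^ e)"
      using fls_subdegree_one_plus_X_power_minus_one[OF p n(1)] .
    define D where "D = fls_subdegree (Q n)"
    \<comment> \<open>Large enough that the remainder order \<open>B + (n + 1) * N\<close> exceeds
      \<open>D + n * N + p ^ e\<close>, the larger of the two orders to be compared.\<close>
    define N where "N = nat (D + int (p ^ e) + 1 - B)"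
    define t s :: "'a fls" where "t = fls_X ^ N" and "s = fls_X ^ N * (1 + fls_X)"
    have X: "fls_subdegree (1 + fls_X :: 'a fls) = 0" "1 + fls_X \<noteq> (0 :: 'a fls)"
      using fls_subdegree_add_eq[of "1 :: 'a fls" fls_X]
      by (simp_all add: fls_vanishes_below_iff)
    have t: "t \<noteq> 0" "fls_subdegree t = int N" and s: "s \<noteq> 0" "fls_subdegree s = int N"
      using X by (simp_all add: t_def s_def fls_subdegree_pow)
    have sn: "s ^ n = t ^ n * (1 + fls_X) ^ n"
      by (simp only: s_def t_def power_mult_distrib)
    define R where "R u = h u - (Q 0 + Q n * u ^ n)" for u
    let ?K = "D + int n * int N + int (p ^ e) + 1"
    have R: "fls_vanishes_below ?K (R u)" if "fls_subdegree u = int N" for u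
    proof -
      have "fls_vanishes_below (B + (int n + 1) * int N) (R u)"
        using rem[of N u n] that unfolding R_def sumQ by (simp add: fls_vanishes_below_iff)
      moreover have "?K \<le> B + (int n + 1) * int N"
        unfolding N_def by (simp add: algebra_simps)
      ultimately show ?thesis by (rule fls_vanishes_below_mono)
    qed
    \<comment> \<open>The leading coefficient of a difference is nonzero in at least one of the two
      values, and \<open>supp\<close> applies to that value.\<close>
    have dvd: "int l dvd fls_subdegree (h u - h v)"
      if "fls_subdegree u \<ge> 0" "fls_subdegree v \<ge> 0" "h u - h v \<noteq> 0" for u v
    proof -
      have "(h u - h v) $$ fls_subdegree (h u - h v) \<noteq> 0"
        by (rule nth_fls_subdegree_nonzero) fact
      hence "h u $$ fls_subdegree (h u - h v) \<noteq> 0 \<or> h v $$ fls_subdegree (h u - h v) \<noteq> 0"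
        by auto
      thus ?thesis using supp[OF that(1)] supp[OF that(2)] by (elim disjE)
    qed
    have leading_t: "Q n * t ^ n \<noteq> 0" "fls_subdegree (Q n * t ^ n) = D + int n * int N"
      using n(2) t by (simp_all add: D_def fls_subdegree_pow)
    have diff_t: "h t - h 0 = Q n * t ^ n + R t"
      using \<open>h 0 = Q 0\<close> by (simp add: R_def)
    have "fls_vanishes_below (fls_subdegree (Q n * t ^ n) + 1) (R t)"
      unfolding leading_t(2) using R[OF t(2)] by (rule fls_vanishes_below_mono) simp
    from fls_subdegree_add_eq[OF leading_t(1) this]
    have "int l dvd fls_subdegree (Q n * t ^ n)"
      using dvd[of t 0] t(2) unfolding diff_t by simp
    hence 1: "int l dvd D + int n * int N" unfolding leading_t(2) .
    \<comment> \<open>This is \<open>Q n * s ^ n - Q n * t ^ n\<close>; the constant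
      \<open>Q 0\<close> cancels in \<open>h s - h t\<close>.\<close>
    define L where "L = Q n * t ^ n * ((1 + fls_X) ^ n - 1)"
    have leading_s: "L \<noteq> 0" "fls_subdegree L = D + int n * int N + int (p ^ e)"
      unfolding L_def using leading_t e by simp_all
    have diff_s: "h s - h t = L + (R s - R t)"
      unfolding R_def sn L_def by (simp add: algebra_simps)
    have "fls_vanishes_below (fls_subdegree L + 1) (R s - R t)"
      unfolding leading_s(2) by (rule fls_vanishes_below_diff[OF R[OF s(2)] R[OF t(2)]])
    from fls_subdegree_add_eq[OF leading_s(1) this]
    have "int l dvd fls_subdegree L"
      using dvd[of s t] s(2) t(2) unfolding diff_s by simp
    hence "int l dvd D + int n * int N + int (p ^ e)" unfolding leading_s(2) .
    with 1 have "int l dvd int (p ^ e)" by (simp add: dvd_add_right_iff)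
    hence "l dvd p ^ e" by (simp only: int_dvd_int_iff)
    hence "is_unit l"
      using coprime_absorb_left[of l "p ^ e"] l(2) by (simp add: coprime_commute)
    with l(1) show ?thesis by simp
  qed
  ultimately show ?thesis by simp
qed

section \<open>Analytic functions with values in the series in a power of the variable\<close>

text \<open>A partial sum close enough to \<open>s\<close> has the same coefficient at
  \<open>j\<close>, and its exponents are multiples of \<open>l\<close>.\<close>

lemma power_series_in_X_power_nth:
  assumes "s \<in> power_series_in_X_power l" "s $$ j \<noteq> 0"
  shows "int l dvd j"
proof (rule ccontr)
  assume j: "\<not> int l dvd j"
  obtain a where "(\<lambda>k. fls_const (a k) * fls_X ^ (l * k)) sums s"
    using assms(1) by (auto simp: power_series_in_X_power_def)
  \<comment> \<open>Vanishing below \<open>j + 1\<close> is what includes the coefficient at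
    \<open>j\<close>.\<close>
  hence "\<forall>\<^sub>F n in sequentially.
      dist (\<Sum>k<n. fls_const (a k) * fls_X ^ (l * k)) s < 2 powi (- (j + 1))"
    unfolding sums_def by (rule tendstoD) simp
  then obtain n where
    "dist (\<Sum>k<n. fls_const (a k) * fls_X ^ (l * k)) s < 2 powi (- (j + 1))"
    by (auto simp: eventually_sequentially)
  from dist_less_imp_vanishes_below[OF this]
  have "(\<Sum>k<n. fls_const (a k) * fls_X ^ (l * k)) $$ j = s $$ j"
    by (simp add: fls_vanishes_below_def)
  moreover have "(\<Sum>k<n. fls_const (a k) * fls_X ^ (l * k)) $$ j = 0"
    using j by (auto simp: fls_nth_sum intro!: sum.neutral)
  ultimately show False using assms(2) by simp
qed

text \<open>On the line from \<open>a\<close> to \<open>x\<close>, each monomial is scaled by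
  \<open>t\<close> to its total degree, which gives a power series in \<open>t\<close>. Every point
  of the polydisc of convergence is reached in this way, so that polydisc itself serves.\<close>

lemma fls_analytic_locally_constant:
  fixes g :: "(nat \<Rightarrow> 'a::field fls) \<Rightarrow> 'a fls"
  assumes p: "prime p" "CHAR('a) = p" and l: "l \<ge> 2" "coprime p l"
    and g: "fls_analytic m U g" "g ` U \<subseteq> power_series_in_X_power l" and a: "a \<in> U"
  obtains r where "r > 0" "\<forall>x\<in>fls_polydisc m a r. g x = g a"
proof -
  obtain r c where r: "r > 0" "fls_polydisc m a r \<subseteq> U" and
    sum: "\<forall>x\<in>fls_polydisc m a r.
       ((\<lambda>\<alpha>. c \<alpha> * (\<Prod>i<m. (x i - a i) ^ \<alpha> i)) has_sum g x) (multi_indices m)"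
    using g(1) a unfolding fls_analytic_def by blast
  have "a \<in> topspace (fls_space m)"
    using g(1) a openin_subset unfolding fls_analytic_def by blast
  hence a': "a \<in> extensional {..<m}"
    by (simp add: fls_space_def PiE_def)
  have "g x = g a" if x: "x \<in> fls_polydisc m a r" for x
  proof -
    define y where "y t = (\<lambda>i\<in>{..<m}. a i + t * (x i - a i))" for t
    define T where "T \<alpha> = c \<alpha> * (\<Prod>i<m. (x i - a i) ^ \<alpha> i)" for \<alpha>
    have y: "y t \<in> fls_polydisc m a r" if "fls_subdegree t \<ge> 0" for t
      using x le_less_trans[OF dist_fls_scale_le[OF that]]
      by (auto simp: fls_polydisc_def fls_space_def y_def)
    have x': "x \<in> extensional {..<m}"
      using x by (auto simp: fls_polydisc_def fls_space_def PiE_def)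
    have "g (y 1) = g (y 0)"
    proof (rule fls_power_series_eq_at_0_1[OF p l, where h = "\<lambda>t. g (y t)"])
      show "((\<lambda>\<alpha>. T \<alpha> * t ^ (\<Sum>i<m. \<alpha> i)) has_sum g (y t)) (multi_indices m)"
        if "fls_subdegree t \<ge> 0" for t
      proof -
        have "c \<alpha> * (\<Prod>i<m. (y t i - a i) ^ \<alpha> i) = T \<alpha> * t ^ (\<Sum>i<m. \<alpha> i)" for \<alpha>
          by (simp add: T_def y_def power_mult_distrib prod.distrib power_sum mult_ac)
        with bspec[OF sum y[OF that]] show ?thesis by simp
      qed
      show "finite {\<alpha> \<in> multi_indices m. (\<Sum>i<m. \<alpha> i) \<le> n}" for n
      proof (rule finite_subset)
        show "{\<alpha> \<in> multi_indices m. (\<Sum>i<m. \<alpha> i) \<le> n} \<subseteq> {..<m} \<rightarrow>\<^sub>E {..n}"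
        proof
          fix \<alpha> assume \<alpha>: "\<alpha> \<in> {\<alpha> \<in> multi_indices m. (\<Sum>i<m. \<alpha> i) \<le> n}"
          have "\<alpha> i \<le> n" if "i < m" for i
            using member_le_sum[of i "{..<m}" \<alpha>] that \<alpha> by auto
          thus "\<alpha> \<in> {..<m} \<rightarrow>\<^sub>E {..n}" using \<alpha> by (auto simp: multi_indices_def PiE_def)
        qed
      qed (auto intro: finite_PiE)
      show "int l dvd j" if "fls_subdegree t \<ge> 0" "g (y t) $$ j \<noteq> 0" for t j
      proof (rule power_series_in_X_power_nth[OF _ that(2)])
        show "g (y t) \<in> power_series_in_X_power l" using y[OF that(1)] r(2) g(2) by blast
      qed
    qed
    \<comment> \<open>All these functions are \<open>undefined\<close> off \<open>{..<m}\<close>, so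
      agreement on the coordinates gives equality.\<close>
    moreover have "y 1 = x" "y 0 = a"
      using x' a' by (auto simp: y_def fun_eq_iff extensional_def)
    ultimately show ?thesis by simp
  qed
  with r(1) show ?thesis by (intro that[of r]) auto
qed

section \<open>Transfer to manifolds through charts\<close>

lemma openin_fls_polydisc: "openin (fls_space m) (fls_polydisc m a r)"
proof -
  have "fls_polydisc m a r = (\<Pi>\<^sub>E i\<in>{..<m}. ball (a i) r)"
    by (auto simp: fls_polydisc_def fls_space_def PiE_def dist_commute)
  thus ?thesis by (simp add: fls_space_def openin_PiE)
qed

lemma CHAR_eq_prime_CARD:
  assumes "prime p" "CARD('a::field) = p"
  shows "CHAR('a) = p"
proof -
  have "CHAR('a) dvd p" using CHAR_dvd_CARD[where ?'a = 'a] assms(2) by simp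
  thus ?thesis using assms(1) CHAR_not_1[where ?'a = 'a] by (auto simp: prime_nat_iff)
qed

theorem theorem1p4:
  fixes p l :: nat
  assumes "prime p" and "CARD('a::field) = p" and "l \<ge> 2" and "coprime p l"
  shows "constancy_enforcing TYPE('z) euclidean {fls_chart :: ('a fls, 'a fls) chart}
           (power_series_in_X_power l)"
  unfolding constancy_enforcing_def
proof (intro conjI allI impI)
  fix Z :: "'z topology" and A :: "('z, 'a fls) chart set" and f :: "'z \<Rightarrow> 'a fls"
  assume *: "analytic_manifold Z A \<and> analytic_map Z A euclidean {fls_chart} f \<and>
    f ` topspace Z \<subseteq> power_series_in_X_power l"
  show "locally_constant Z f"
    unfolding locally_constant_def
  proof
    fix z assume "z \<in> topspace Z"
    then obtain c where c: "c \<in> A" "z \<in> chart_dom c" and on: "chart_on Z c"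
      using * unfolding analytic_manifold_def by blast
    let ?m = "chart_dim c" and ?\<phi> = "chart_map c"
    have dom: "openin Z (chart_dom c)"
      and hom: "homeomorphic_map (subtopology Z (chart_dom c))
             (subtopology (fls_space ?m) (chart_range c)) ?\<phi>"
      using on by (auto simp: chart_on_def)
    have sub: "chart_dom c \<subseteq> topspace Z" using dom by (rule openin_subset)
    have inj: "inj_on ?\<phi> (chart_dom c)"
      using homeomorphic_imp_injective_map[OF hom] sub by (simp add: inf_absorb2)
    have inv: "chart_inv c (?\<phi> w) = w" if "w \<in> chart_dom c" for w
      using that inj by (simp add: chart_inv_def)
    \<comment> \<open>This is \<open>f\<close> read in the chart \<open>c\<close>. The only
      coordinate of \<open>fls_chart\<close> is the value itself, so analyticity of \<open>f\<close>
      becomes analyticity of a scalar function.\<close>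
    let ?g = "\<lambda>x. f (chart_inv c x)"
    have "fls_analytic ?m (?\<phi> ` chart_dom c) ?g"
      using * c(1) by (simp add: analytic_map_def fls_analytic_vec_def fls_chart_def o_def)
    moreover have "?g ` (?\<phi> ` chart_dom c) \<subseteq> power_series_in_X_power l"
    proof (clarsimp simp: inv)
      fix w assume "w \<in> chart_dom c"
      thus "f w \<in> power_series_in_X_power l" using * sub by blast
    qed
    moreover have "?\<phi> z \<in> ?\<phi> ` chart_dom c" using c(2) by blast
    ultimately obtain r where r: "r > 0"
      "\<forall>x\<in>fls_polydisc ?m (?\<phi> z) r. ?g x = ?g (?\<phi> z)"
      by (rule fls_analytic_locally_constant
        [OF assms(1) CHAR_eq_prime_CARD[OF assms(1,2)] assms(3,4)])
    \<comment> \<open>The polydisc pulled back along the chart: open in the chart domain, hence open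
      in \<open>Z\<close>.\<close>
    let ?W = "{w \<in> chart_dom c. ?\<phi> w \<in> fls_polydisc ?m (?\<phi> z) r}"
    have "continuous_map (subtopology Z (chart_dom c)) (fls_space ?m) ?\<phi>"
      using homeomorphic_imp_continuous_map[OF hom] continuous_map_in_subtopology by blast
    from openin_continuous_map_preimage[OF this openin_fls_polydisc]
    have "openin (subtopology Z (chart_dom c)) ?W" using sub by (simp add: inf_absorb2)
    hence "openin Z ?W" using dom openin_trans_full by blast
    moreover have "z \<in> ?W"
    proof -
      have "?\<phi> z \<in> topspace (fls_space ?m)"
        using on c(2) openin_subset unfolding chart_on_def chart_range_def by blast
      thus ?thesis using c(2) r(1) by (simp add: fls_polydisc_def)
    qed
    moreover have "f w = f z" if "w \<in> ?W" for w
      using bspec[OF r(2), of "?\<phi> w"] that inv c(2) by simp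
    hence "f constant_on ?W" unfolding constant_on_def by blast
    ultimately show "\<exists>U. openin Z U \<and> z \<in> U \<and> f constant_on U" by blast
  qed
qed (simp_all add: analytic_manifold_fls)

end
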